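(* Let $X,Y$ be nonempty sets and let $c:X\times Y\to\mathbb{R}$ be any function. Suppose that $f:X\to(-\infty,+\infty]$ is a $c$-antiderivative of the mapping $M:X\rightrightarrows Y$ and that $\emptyset\neq S\subset\mathrm{dom}(M)$. Let $\mathcal{A}_{[c,f|_S,M]}$ be the set of all $c$-convex functions $h:X\to(-\infty,+\infty]$ with $G(M)\subset G(\partial_c h)$ and $h|_S=f|_S$. Then the function $\alpha_{[c,f|_S,M]}:X\to(-\infty,+\infty]$ given by $$\alpha_{[c,f|_S,M]}(x)=\sup_{s\in S}\,[f(s)+R_{[c,M,s]}(x)]\qquad\forall x\in X$$ belongs to $\mathcal{A}_{[c,f|_S,M]}$ and is the minimal $c$-antiderivative of $M$ that equals $f$ at the points of $S$; that is, $\alpha_{[c,f|_S,M]}\le h$ pointwise for every $c$-antiderivative $h:X\to(-\infty,+\infty]$ of $M$ with $h|_S=f|_S$.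
   Context: A function $f:X\to(-\infty,+\infty]$ is proper if it is finite at some point. A proper function $f:X\to(-\infty,+\infty]$ is $c$-convex if there is $g:Y\to(-\infty,+\infty]$ with $f(x)=\sup_{y\in Y}[c(x,y)-g(y)]$ for all $x\in X$. For a multivalued mapping $M:X\rightrightarrows Y$: $G(M)=\{(x,y): y\in M(x)\}$ and $\mathrm{dom}(M)=\{x: M(x)\neq\emptyset\}$. For proper $f$, the $c$-subdifferential $\partial_c f:X\rightrightarrows Y$ is $\partial_c f(x)=\{y\in Y: f(x)+c(x',y)\le f(x')+c(x,y)\ \forall x'\in X\}$. A proper function $f$ is a $c$-antiderivative of $M$ if $G(M)\subset G(\partial_c f)$. For $s\in\mathrm{dom}(M)$, Rockafellar's function is $$R_{[c,M,s]}(x):=\sup\Big\{\sum_{i=1}^n[c(x_{i+1},y_i)-c(x_i,y_i)] : n\in\mathbb{N},\ n\ge1,\ \{(x_i,y_i)\}_{i=1}^n\subset G(M),\ x_1=s,\ x_{n+1}=x\Big\},\quad x\in X.$$ *)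

theory Defs
  imports Complex_Main "HOL-Library.Extended_Real"
begin

text \<open>
  The nonempty sets \<open>X\<close> and \<open>Y\<close> are the universes of the types \<open>'x\<close> and \<open>'y\<close>, and a
  multivalued mapping from \<open>X\<close> to \<open>Y\<close> is a function \<open>'x \<Rightarrow> 'y set\<close>.  A function with values
  in \<open>(-\<infinity>, +\<infinity>]\<close> is an \<open>ereal\<close>-valued function that never takes the value \<open>-\<infinity>\<close>.
\<close>

definition no_minus_inf :: "('a \<Rightarrow> ereal) \<Rightarrow> bool" where
  "no_minus_inf f \<longleftrightarrow> (\<forall>x. f x \<noteq> -\<infinity>)"

definition proper_fun :: "('a \<Rightarrow> ereal) \<Rightarrow> bool" where
  "proper_fun f \<longleftrightarrow> no_minus_inf f \<and> (\<exists>x. \<bar>f x\<bar> \<noteq> \<infinity>)"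

definition c_convex :: "('x \<Rightarrow> 'y \<Rightarrow> real) \<Rightarrow> ('x \<Rightarrow> ereal) \<Rightarrow> bool" where
  "c_convex c f \<longleftrightarrow> proper_fun f \<and>
     (\<exists>g :: 'y \<Rightarrow> ereal. no_minus_inf g \<and> (\<forall>x. f x = (SUP y. ereal (c x y) - g y)))"

definition mv_graph :: "('x \<Rightarrow> 'y set) \<Rightarrow> ('x \<times> 'y) set" where
  "mv_graph M = {(x, y). y \<in> M x}"

definition mv_dom :: "('x \<Rightarrow> 'y set) \<Rightarrow> 'x set" where
  "mv_dom M = {x. M x \<noteq> {}}"

definition c_subdiff :: "('x \<Rightarrow> 'y \<Rightarrow> real) \<Rightarrow> ('x \<Rightarrow> ereal) \<Rightarrow> 'x \<Rightarrow> 'y set" where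
  "c_subdiff c f x = {y. \<forall>x'. f x + ereal (c x' y) \<le> f x' + ereal (c x y)}"

definition c_antiderivative ::
  "('x \<Rightarrow> 'y \<Rightarrow> real) \<Rightarrow> ('x \<Rightarrow> 'y set) \<Rightarrow> ('x \<Rightarrow> ereal) \<Rightarrow> bool" where
  "c_antiderivative c M f \<longleftrightarrow> proper_fun f \<and> mv_graph M \<subseteq> mv_graph (c_subdiff c f)"

text \<open>
  In the following, only the entries \<open>xs 1, \<dots>, xs (n + 1)\<close> and \<open>ys 1, \<dots>, ys n\<close> of the
  sequences matter; the end point \<open>xs (n + 1) = x\<close> need not lie in the domain of \<open>M\<close>.
\<close>

definition rockafellar ::
  "('x \<Rightarrow> 'y \<Rightarrow> real) \<Rightarrow> ('x \<Rightarrow> 'y set) \<Rightarrow> 'x \<Rightarrow> 'x \<Rightarrow> ereal" where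
  "rockafellar c M s x =
     Sup {ereal (\<Sum>i = 1..n. c (xs (i + 1)) (ys i) - c (xs i) (ys i)) |
            (n :: nat) (xs :: nat \<Rightarrow> 'x) (ys :: nat \<Rightarrow> 'y).
            1 \<le> n \<and> (\<forall>i \<in> {1..n}. (xs i, ys i) \<in> mv_graph M) \<and> xs 1 = s \<and> xs (n + 1) = x}"

text \<open>The next two notions depend on \<open>f\<close> only through its restriction to \<open>S\<close>.\<close>

definition c_convex_antiderivs ::
  "('x \<Rightarrow> 'y \<Rightarrow> real) \<Rightarrow> ('x \<Rightarrow> ereal) \<Rightarrow> 'x set \<Rightarrow> ('x \<Rightarrow> 'y set) \<Rightarrow> ('x \<Rightarrow> ereal) set" where
  "c_convex_antiderivs c f S M =
     {h. c_convex c h \<and> mv_graph M \<subseteq> mv_graph (c_subdiff c h) \<and> (\<forall>s\<in>S. h s = f s)}"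

definition min_antideriv ::
  "('x \<Rightarrow> 'y \<Rightarrow> real) \<Rightarrow> ('x \<Rightarrow> ereal) \<Rightarrow> 'x set \<Rightarrow> ('x \<Rightarrow> 'y set) \<Rightarrow> 'x \<Rightarrow> ereal" where
  "min_antideriv c f S M x = (SUP s\<in>S. f s + rockafellar c M s x)"

end

theory Submission
  imports Defs
begin

text \<open>
  Write \<open>d x y x'\<close> for the increment \<open>c x' y - c x y\<close> and say that \<open>\<phi>\<close> dominates its increments
  if \<open>\<phi> x + d x y x' \<le> \<phi> x'\<close> whenever \<open>y \<in> M x\<close>.  For a proper \<open>\<phi>\<close> this says exactly that
  \<open>\<phi>\<close> is a \<open>c\<close>-antiderivative of \<open>M\<close>.  The value of Rockafellar's function at \<open>x\<close> is the
  supremum of the total increments along chains in the graph of \<open>M\<close> that lead from \<open>s\<close> to \<open>x\<close>.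
  Chains can be prolonged, so \<open>\<alpha> = min_antideriv c f S M\<close> dominates its increments
  (\<open>min_antideriv_increment\<close>); and a function that dominates its increments does so along whole
  chains, so \<open>\<alpha>\<close> is the least function of this kind that is at least \<open>f\<close> on \<open>S\<close>
  (\<open>min_antideriv_least\<close>).

  The theorem follows by using this minimality twice.  Comparing \<open>\<alpha>\<close> with a
  \<open>c\<close>-antiderivative \<open>h\<close> that equals \<open>f\<close> on \<open>S\<close> gives \<open>\<alpha> \<le> h\<close>, and for \<open>h = f\<close> it gives
  \<open>\<alpha> \<le> f\<close> on \<open>S\<close>, where trivial chains from \<open>s\<close> to \<open>s\<close> give the other inequality.  Comparing
  \<open>\<alpha>\<close> with \<open>x \<mapsto> SUP (x', y). \<alpha> x' + d x' y x\<close>, taken over the graph of \<open>M\<close>, shows that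
  \<open>\<alpha>\<close> is bounded above by, hence is, a supremum of functions of the form
  \<open>c(\<cdot>, y) + constant\<close>, that is, \<open>c\<close>-convex (\<open>c_convexI_increment_SUP\<close>).
\<close>

lemma ereal_add_le_iff_le_minus:
  fixes u w :: ereal
  shows "u + ereal d \<le> w \<longleftrightarrow> u \<le> w - ereal d"
  by (cases u; cases w) auto

lemma mem_c_subdiff_iff_increment:
  "y \<in> c_subdiff c h x \<longleftrightarrow> (\<forall>x'. h x + ereal (c x' y - c x y) \<le> h x')"
proof -
  have "h x + ereal (c x' y) \<le> h x' + ereal (c x y) \<longleftrightarrow>
        h x + ereal (c x' y - c x y) \<le> h x'" for x'
    by (cases "h x"; cases "h x'") auto
  then show ?thesis
    by (simp add: c_subdiff_def)
qed

lemma mv_graph_subset_c_subdiff_iff: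
  "mv_graph M \<subseteq> mv_graph (c_subdiff c h) \<longleftrightarrow>
     (\<forall>x y x'. y \<in> M x \<longrightarrow> h x + ereal (c x' y - c x y) \<le> h x')"
  by (auto simp: mv_graph_def mem_c_subdiff_iff_increment)

text \<open>
  An infinite value at \<open>x\<close> would propagate to all points through the subgradient inequality,
  contradicting properness.
\<close>

lemma c_antiderivative_finite_on_dom:
  assumes "c_antiderivative c M h" and "y \<in> M x"
  shows "\<bar>h x\<bar> \<noteq> \<infinity>"
proof -
  from assms(1) obtain z where z: "\<bar>h z\<bar> \<noteq> \<infinity>"
    unfolding c_antiderivative_def proper_fun_def by (elim conjE exE)
  have "h x + ereal (c z y - c x y) \<le> h z"
    using assms by (auto simp: c_antiderivative_def mv_graph_subset_c_subdiff_iff)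
  moreover have "h x \<noteq> -\<infinity>"
    using assms(1) by (auto simp: c_antiderivative_def proper_fun_def no_minus_inf_def)
  ultimately show ?thesis
    using z by (cases "h x"; cases "h z") auto
qed

section \<open>Chains and Rockafellar's function\<close>

lemma rockafellar_upper:
  fixes n :: nat
  assumes "1 \<le> n" and "\<And>i. i \<in> {1..n} \<Longrightarrow> ys i \<in> M (xs i)" and "xs 1 = s" and "xs (n + 1) = x"
  shows "ereal (\<Sum>i = 1..n. c (xs (i + 1)) (ys i) - c (xs i) (ys i)) \<le> rockafellar c M s x"
  unfolding rockafellar_def
  by (rule Sup_upper, rule CollectI, intro exI[of _ n] exI[of _ xs] exI[of _ ys])
    (use assms in \<open>auto simp: mv_graph_def\<close>)

lemma rockafellar_single_step:
  assumes "y \<in> M s"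
  shows "ereal (c x y - c s y) \<le> rockafellar c M s x"
  using rockafellar_upper[of 1 "\<lambda>_. y" M "\<lambda>i. if i = 1 then s else x" s x c] assms by simp

text \<open>A chain that ends at \<open>x\<close> can be prolonged by any pair \<open>(x, y)\<close> of the graph.\<close>

lemma rockafellar_increment:
  assumes "y \<in> M x"
  shows "rockafellar c M s x + ereal (c x' y - c x y) \<le> rockafellar c M s x'"
proof -
  have "rockafellar c M s x \<le> rockafellar c M s x' - ereal (c x' y - c x y)"
    unfolding rockafellar_def[of c M s x]
  proof (rule Sup_least, clarify)
    fix n :: nat and xs ys
    assume n: "1 \<le> n" and G: "\<forall>i\<in>{1..n}. (xs i, ys i) \<in> mv_graph M"
      and ends: "s = xs 1" "x = xs (n + 1)"
    let ?xs = "xs(n + 2 := x')" and ?ys = "ys(n + 1 := y)"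
    have "(\<Sum>i = 1..n + 1. c (?xs (i + 1)) (?ys i) - c (?xs i) (?ys i)) =
          (\<Sum>i = 1..n. c (xs (i + 1)) (ys i) - c (xs i) (ys i)) + (c x' y - c x y)"
      using ends by (simp)
    moreover have "ereal (\<Sum>i = 1..n + 1. c (?xs (i + 1)) (?ys i) - c (?xs i) (?ys i))
        \<le> rockafellar c M s x'"
      by (rule rockafellar_upper) (use n G ends assms in \<open>auto simp: mv_graph_def\<close>)
    ultimately show "ereal (\<Sum>i = 1..n. c (xs (i + 1)) (ys i) - c (xs i) (ys i)) \<le>
        rockafellar c M (xs 1) x' - ereal (c x' y - c (xs (n + 1)) y)"
      unfolding ereal_add_le_iff_le_minus[symmetric] using ends by simp
  qed
  then show ?thesis
    by (simp only: ereal_add_le_iff_le_minus)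
qed

lemma chain_sum_le:
  fixes \<phi> :: "'x \<Rightarrow> ereal" and n :: nat
  assumes step: "\<And>x y x'. y \<in> M x \<Longrightarrow> \<phi> x + ereal (c x' y - c x y) \<le> \<phi> x'"
    and "\<And>i. i \<in> {1..n} \<Longrightarrow> ys i \<in> M (xs i)"
  shows "\<phi> (xs 1) + ereal (\<Sum>i = 1..n. c (xs (i + 1)) (ys i) - c (xs i) (ys i)) \<le> \<phi> (xs (n + 1))"
  using assms(2)
proof (induction n)
  case 0
  then show ?case by (simp flip: zero_ereal_def)
next
  case (Suc n)
  let ?t = "c (xs (Suc n + 1)) (ys (Suc n)) - c (xs (Suc n)) (ys (Suc n))"
  have "\<phi> (xs 1) + ereal (\<Sum>i = 1..Suc n. c (xs (i + 1)) (ys i) - c (xs i) (ys i)) =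
      \<phi> (xs 1) + ereal (\<Sum>i = 1..n. c (xs (i + 1)) (ys i) - c (xs i) (ys i)) + ereal ?t"
    by (simp add: add.assoc)
  also have "\<dots> \<le> \<phi> (xs (n + 1)) + ereal ?t"
    by (rule add_right_mono) (use Suc in auto)
  also have "\<dots> \<le> \<phi> (xs (Suc n + 1))"
    using step[OF Suc.prems[of "Suc n"]] by simp
  finally show ?case .
qed

text \<open>
  The base value \<open>a\<close> is finite so that the bound \<open>a + v \<le> \<phi> x\<close> on each total increment \<open>v\<close> can be
  read as a bound on \<open>v\<close>, and hence on their supremum.
\<close>

lemma rockafellar_least:
  fixes \<phi> :: "'x \<Rightarrow> ereal"
  assumes step: "\<And>x y x'. y \<in> M x \<Longrightarrow> \<phi> x + ereal (c x' y - c x y) \<le> \<phi> x'"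
    and "\<bar>a\<bar> \<noteq> \<infinity>" and "a \<le> \<phi> s"
  shows "a + rockafellar c M s x \<le> \<phi> x"
proof -
  obtain r where r: "a = ereal r"
    using assms(2) by auto
  have "rockafellar c M s x \<le> \<phi> x - ereal r"
    unfolding rockafellar_def
  proof (rule Sup_least, clarify)
    fix n :: nat and xs ys
    assume G: "\<forall>i\<in>{1..n}. (xs i, ys i) \<in> mv_graph M" and ends: "s = xs 1" "x = xs (n + 1)"
    let ?v = "ereal (\<Sum>i = 1..n. c (xs (i + 1)) (ys i) - c (xs i) (ys i))"
    have "?v + ereal r \<le> \<phi> (xs 1) + ?v"
      unfolding add.commute[of ?v] using assms(3) r ends by (intro add_right_mono) simp
    also have "\<dots> \<le> \<phi> (xs (n + 1))"
      by (rule chain_sum_le[where M = M]) (use step G in \<open>auto simp: mv_graph_def\<close>)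
    finally show "?v \<le> \<phi> (xs (n + 1)) - ereal r"
      by (simp only: ereal_add_le_iff_le_minus)
  qed
  then show ?thesis
    unfolding r add.commute[of "ereal r"] by (simp only: ereal_add_le_iff_le_minus)
qed

section \<open>The least function that dominates its increments\<close>

lemma min_antideriv_increment:
  assumes "y \<in> M x"
  shows "min_antideriv c f S M x + ereal (c x' y - c x y) \<le> min_antideriv c f S M x'"
proof -
  have "f s + rockafellar c M s x \<le> min_antideriv c f S M x' - ereal (c x' y - c x y)"
    if "s \<in> S" for s
  proof -
    have "f s + rockafellar c M s x + ereal (c x' y - c x y) \<le> f s + rockafellar c M s x'"
      unfolding add.assoc by (rule add_left_mono) (rule rockafellar_increment[where M = M, OF assms])
    also have "\<dots> \<le> min_antideriv c f S M x'"
      unfolding min_antideriv_def using that by (rule SUP_upper)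
    finally show ?thesis
      by (simp only: ereal_add_le_iff_le_minus)
  qed
  then have "min_antideriv c f S M x \<le> min_antideriv c f S M x' - ereal (c x' y - c x y)"
    unfolding min_antideriv_def[of c f S M x] by (rule SUP_least)
  then show ?thesis
    by (simp only: ereal_add_le_iff_le_minus)
qed

lemma min_antideriv_least:
  fixes \<phi> :: "'x \<Rightarrow> ereal"
  assumes "\<And>x y x'. y \<in> M x \<Longrightarrow> \<phi> x + ereal (c x' y - c x y) \<le> \<phi> x'"
    and "\<And>s. s \<in> S \<Longrightarrow> \<bar>f s\<bar> \<noteq> \<infinity> \<and> f s \<le> \<phi> s"
  shows "min_antideriv c f S M x \<le> \<phi> x"
  unfolding min_antideriv_def
  by (rule SUP_least, rule rockafellar_least[where M = M]) (use assms in auto)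

lemma min_antideriv_lower:
  assumes "s \<in> S" and "y \<in> M s"
  shows "f s + ereal (c x y - c s y) \<le> min_antideriv c f S M x"
proof -
  have "f s + ereal (c x y - c s y) \<le> f s + rockafellar c M s x"
    by (rule add_left_mono) (use assms(2) in \<open>rule rockafellar_single_step\<close>)
  also have "\<dots> \<le> min_antideriv c f S M x"
    unfolding min_antideriv_def using assms(1) by (rule SUP_upper)
  finally show ?thesis .
qed

section \<open>Convexity\<close>

text \<open>
  The witness is the \<open>c\<close>-conjugate \<open>g y = SUP x. c x y - h x\<close>, for which
  \<open>c x y - g y \<le> h x\<close> always holds.  If \<open>y\<close> is a subgradient of \<open>h\<close> at \<open>x'\<close>, then the supremum
  defining \<open>g y\<close> is attained at \<open>x'\<close>, so \<open>c x y - g y\<close> is \<open>h x' + (c x y - c x' y)\<close>, and the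
  hypothesis bounds \<open>h\<close> by the supremum of these.
\<close>

lemma c_convexI_increment_SUP:
  assumes anti: "c_antiderivative c M h"
    and le: "\<And>x. h x \<le> (SUP (x', y) \<in> mv_graph M. h x' + ereal (c x y - c x' y))"
  shows "c_convex c h"
proof -
  define g where "g y = (SUP x. ereal (c x y) - h x)" for y
  have proper: "proper_fun h"
    using anti by (simp add: c_antiderivative_def)
  then obtain z where z: "\<bar>h z\<bar> \<noteq> \<infinity>"
    unfolding proper_fun_def by (elim conjE exE)
  have g_ge: "ereal (c x y) - h x \<le> g y" for x y
    unfolding g_def by (rule SUP_upper) simp
  have "g y \<noteq> -\<infinity>" for y
    using g_ge[of z y] z by (cases "h z") auto
  then have g_proper: "no_minus_inf g"
    by (simp add: no_minus_inf_def)
  have "h x = (SUP y. ereal (c x y) - g y)" for x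
  proof (rule antisym)
    have "h x' + ereal (c x y - c x' y) \<le> (SUP y. ereal (c x y) - g y)" if y: "y \<in> M x'" for x' y
    proof -
      obtain r where r: "h x' = ereal r"
        using c_antiderivative_finite_on_dom[OF anti y] by auto
      have "g y \<le> ereal (c x' y - r)"
        unfolding g_def
      proof (rule SUP_least)
        fix x''
        have "ereal r + ereal (c x'' y - c x' y) \<le> h x''"
          using anti y by (simp add: c_antiderivative_def mv_graph_subset_c_subdiff_iff flip: r)
        then show "ereal (c x'' y) - h x'' \<le> ereal (c x' y - r)"
          by (cases "h x''") auto
      qed
      then have "h x' + ereal (c x y - c x' y) \<le> ereal (c x y) - g y"
        unfolding r by (cases "g y") auto
      also have "\<dots> \<le> (SUP y. ereal (c x y) - g y)"
        by (rule SUP_upper) simp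
      finally show ?thesis .
    qed
    then have "(SUP (x', y) \<in> mv_graph M. h x' + ereal (c x y - c x' y))
        \<le> (SUP y. ereal (c x y) - g y)"
      by (intro SUP_least) (auto simp: mv_graph_def)
    with le show "h x \<le> (SUP y. ereal (c x y) - g y)"
      by (rule order_trans)
    have "ereal (c x y) - g y \<le> h x" for y
      using g_ge[of x y] by (cases "h x"; cases "g y") auto
    then show "(SUP y. ereal (c x y) - g y) \<le> h x"
      by (rule SUP_least)
  qed
  with proper g_proper show ?thesis
    unfolding c_convex_def by blast
qed

section \<open>The minimal antiderivative\<close>

theorem theorem4p4:
  fixes c :: "'x \<Rightarrow> 'y \<Rightarrow> real"
    and f :: "'x \<Rightarrow> ereal"
    and M :: "'x \<Rightarrow> 'y set"
    and S :: "'x set"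
  assumes "c_antiderivative c M f"
    and "S \<noteq> {}"
    and "S \<subseteq> mv_dom M"
  shows "min_antideriv c f S M \<in> c_convex_antiderivs c f S M \<and>
         (\<forall>h. c_antiderivative c M h \<and> (\<forall>s\<in>S. h s = f s) \<longrightarrow>
              (\<forall>x. min_antideriv c f S M x \<le> h x))"
proof -
  let ?\<alpha> = "min_antideriv c f S M"
  have dom: "\<exists>y. y \<in> M s" if "s \<in> S" for s
    using assms(3) that by (auto simp: mv_dom_def)
  have finite: "\<bar>f s\<bar> \<noteq> \<infinity>" if "s \<in> S" for s
    using dom[OF that] c_antiderivative_finite_on_dom[OF assms(1)] by (elim exE)
  have minimal: "?\<alpha> x \<le> h x" if "c_antiderivative c M h" "\<forall>s\<in>S. h s = f s" for h x
    by (rule min_antideriv_least)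
      (use that finite in \<open>auto simp: c_antiderivative_def mv_graph_subset_c_subdiff_iff\<close>)
  have eq: "?\<alpha> s = f s" if s: "s \<in> S" for s
  proof (rule antisym)
    show "?\<alpha> s \<le> f s"
      using minimal assms(1) by blast
    obtain y where "y \<in> M s"
      using dom[OF s] by blast
    with min_antideriv_lower[where M = M, OF s this, of f c s] show "f s \<le> ?\<alpha> s"
      by (simp flip: zero_ereal_def)
  qed
  obtain s where s: "s \<in> S"
    using assms(2) by blast
  obtain y where y: "y \<in> M s"
    using dom[OF s] by blast
  have "?\<alpha> x \<noteq> -\<infinity>" for x
    using min_antideriv_lower[where M = M, OF s y, of f c x] finite[OF s] by (cases "f s") auto
  moreover have "\<bar>?\<alpha> s\<bar> \<noteq> \<infinity>"
    using eq finite s by simp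
  ultimately have "proper_fun ?\<alpha>"
    unfolding proper_fun_def no_minus_inf_def by (intro conjI allI exI[of _ s])
  then have anti: "c_antiderivative c M ?\<alpha>"
    by (simp add: c_antiderivative_def mv_graph_subset_c_subdiff_iff min_antideriv_increment)
  have "?\<alpha> x \<le> (SUP (x', y) \<in> mv_graph M. ?\<alpha> x' + ereal (c x y - c x' y))" for x
  proof (rule min_antideriv_least)
    let ?\<psi> = "\<lambda>x. SUP (x', y) \<in> mv_graph M. ?\<alpha> x' + ereal (c x y - c x' y)"
    have upper: "?\<alpha> x + ereal (c x' y - c x y) \<le> ?\<psi> x'" if "y \<in> M x" for x x' y
      by (rule SUP_upper2[where i = "(x, y)"]) (use that in \<open>auto simp: mv_graph_def\<close>)
    have "?\<psi> x \<le> ?\<alpha> x" for x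
      by (rule SUP_least) (auto simp: mv_graph_def min_antideriv_increment)
    then show "?\<psi> x + ereal (c x' y - c x y) \<le> ?\<psi> x'" if "y \<in> M x" for x y x'
      using upper[OF that] by (meson add_right_mono order_trans)
    show "\<bar>f s\<bar> \<noteq> \<infinity> \<and> f s \<le> ?\<psi> s" if s: "s \<in> S" for s
    proof -
      obtain y where "y \<in> M s"
        using dom[OF s] by blast
      from upper[OF this, of s] finite[OF s] eq[OF s] show ?thesis
        by (simp flip: zero_ereal_def)
    qed
  qed
  with anti have "c_convex c ?\<alpha>"
    by (rule c_convexI_increment_SUP)
  with anti eq minimal show ?thesis
    by (auto simp: c_convex_antiderivs_def c_antiderivative_def)
qed

end
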